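(* For every non-negative integer $n$, the coefficients $\Psi_k(n)$, $0\le k\le \lfloor n/2\rfloor$, of the expansion $$\frac{x^n+y^n}{(x+y)^{\delta(n)}} = \sum_{k=0}^{\lfloor n/2\rfloor}\Psi_k(n)\,(xy)^{\lfloor n/2\rfloor-k}(x^2+y^2)^k$$ (valid for all complex $x,y$, with $x+y\neq 0$ if $n$ is odd) are integers, and $$\Psi_0(n) = \begin{cases} 2 & n\equiv 0 \pmod 8\\ 1 & n\equiv \pm1 \pmod 8\\ 0 & n\equiv\pm 2\pmod 8\\ -1 & n\equiv \pm 3\pmod 8\\ -2 & n\equiv 4\pmod 8.\end{cases}$$ Moreover, for each $1\le k\le\lfloor n/2\rfloor$: - $n\equiv 0 \pmod 8$: $\Psi_k(n)=0$ for $k$ odd, and $\displaystyle \Psi_k(n)=2(-1)^{\lfloor k/2\rfloor}\frac{\prod_{\lambda=0}^{\lfloor k/2\rfloor-1}[n^2-(4\lambda)^2]}{4^k\,k!}$ for $k$ even. - $n\equiv 2 \pmod 8$: $\Psi_k(n)=0$ for $k$ even, and $\displaystyle \Psi_k(n)=2(-1)^{\lfloor k/2\rfloor}\,n\,\frac{\prod_{\lambda=1}^{\lfloor k/2\rfloor}[n^2-(4\lambda-2)^2]}{4^k\,k!}$ for $k$ odd. - $n\equiv 4 \pmod 8$: $\Psi_k(n)=0$ for $k$ odd, and $\displaystyle \Psi_k(n)=2(-1)^{\lfloor k/2\rfloor+1}\frac{\prod_{\lambda=0}^{\lfloor k/2\rfloor-1}[n^2-(4\lambda)^2]}{4^k\,k!}$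 for $k$ even. - $n\equiv 6 \pmod 8$: $\Psi_k(n)=0$ for $k$ even, and $\displaystyle \Psi_k(n)=2(-1)^{\lfloor k/2\rfloor+1}\,n\,\frac{\prod_{\lambda=1}^{\lfloor k/2\rfloor}[n^2-(4\lambda-2)^2]}{4^k\,k!}$ for $k$ odd. - $n\equiv 1 \pmod 8$: $\displaystyle \Psi_k(n)=(-1)^{\lfloor k/2\rfloor}(n+1-2k)^{\delta(k)}\frac{\prod_{\lambda=1}^{\lfloor k/2\rfloor}[(n+1)^2-(4\lambda-2)^2]}{4^k\,k!}$. - $n\equiv 3 \pmod 8$: $\displaystyle \Psi_k(n)=(-1)^{\lfloor k/2\rfloor+\delta(k-1)}(n+1)(n+1-2k)^{\delta(k-1)}\frac{\prod_{\lambda=1}^{\lfloor (k-1)/2\rfloor}[(n+1)^2-(4\lambda)^2]}{4^k\,k!}$. - $n\equiv 5 \pmod 8$: $\displaystyle \Psi_k(n)=(-1)^{\lfloor k/2\rfloor+1}(n+1-2k)^{\delta(k)}\frac{\prod_{\lambda=1}^{\lfloor k/2\rfloor}[(n+1)^2-(4\lambda-2)^2]}{4^k\,k!}$. - $n\equiv 7 \pmod 8$: $\displaystyle \Psi_k(n)=(-1)^{\lfloor k/2\rfloor+\delta(k)}(n+1)(n+1-2k)^{\delta(k-1)}\frac{\prod_{\lambda=1}^{\lfloor (k-1)/2\rfloor}[(n+1)^2-(4\lambda)^2]}{4^k\,k!}$.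
   Context: For a non-negative integer $m$, $\delta(m)\in\{0,1\}$ denotes the residue of $m$ modulo $2$. The expansion is an identity of polynomials in $x,y$; its coefficients $\Psi_k(n)$ exist and are uniquely determined, because $xy$ and $x^2+y^2$ are algebraically independent. Empty products equal $1$. *)

theory Defs
  imports Complex_Main
begin

definition delta :: "nat \<Rightarrow> nat" where
  "delta m = m mod 2"

definition is_expansion :: "nat \<Rightarrow> (nat \<Rightarrow> complex) \<Rightarrow> bool" where
  "is_expansion n c \<longleftrightarrow>
     (\<forall>x y :: complex. (odd n \<longrightarrow> x + y \<noteq> 0) \<longrightarrow>
        (x ^ n + y ^ n) / (x + y) ^ delta n =
        (\<Sum>k = 0..n div 2. c k * (x * y) ^ (n div 2 - k) * (x\<^sup>2 + y\<^sup>2) ^ k))"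

text \<open>
  The expansion constrains only the coefficients with index at most \<open>n div 2\<close>.
  The vanishing condition on the other indices makes the coefficient function unique,
  so that the definite description below is meaningful.
\<close>

definition Psi :: "nat \<Rightarrow> nat \<Rightarrow> complex" where
  "Psi n = (THE c. is_expansion n c \<and> (\<forall>k > n div 2. c k = 0))"

end

theory Submission
  imports Defs
begin

text \<open>
  With \<open>p = x y\<close> and \<open>s = x\<^sup>2 + y\<^sup>2\<close>, the quotients \<open>F\<^sub>n = (x\<^sup>n + y\<^sup>n) / (x + y)\<^bsup>\<delta>(n)\<^esup>\<close> satisfy
  \<open>F\<^bsub>n+4\<^esub> = s F\<^bsub>n+2\<^esub> - p\<^sup>2 F\<^sub>n\<close>, so the coefficients obey a three-term recurrence in \<open>\<lfloor>n/2\<rfloor>\<close>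
  with integer initial data. Up to sign this recurrence is the difference equation
  \<open>a\<^sub>k(t + 4) - a\<^sub>k(t) = a\<^bsub>k-1\<^esub>(t + 2)\<close>, which is solved by the central factorials with step 4,
  \<open>a\<^sub>k(t) = \<Prod>(t + 2j) / (4\<^sup>k k!)\<close> with \<open>j = -(k-1), -(k-3), \<dots>, k-1\<close>, and by a variant of them.
  Pairing opposite factors turns these into products of differences of squares.
\<close>

section \<open>Integer coefficients from the recurrence\<close>

text \<open>\<open>d\<close> is the parity of \<open>n\<close> and \<open>m\<close> is
  \<open>n div 2\<close>. The two base rows encode 2 and \<open>s\<close> for even \<open>n\<close>,
  and 1 and \<open>s - p\<close> for odd \<open>n\<close>.\<close>

fun expansion_coeff :: "int \<Rightarrow> nat \<Rightarrow> nat \<Rightarrow> int" where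
  "expansion_coeff d 0 k = (if k = 0 then 2 - d else 0)"
| "expansion_coeff d (Suc 0) k = (if k = 0 then - d else if k = 1 then 1 else 0)"
| "expansion_coeff d (Suc (Suc m)) k =
     (if k = 0 then 0 else expansion_coeff d (Suc m) (k - 1)) - expansion_coeff d m k"

lemma expansion_coeff_eq_0: "m < k \<Longrightarrow> expansion_coeff d m k = 0"
  by (induction d m k rule: expansion_coeff.induct) auto

definition expansion_poly :: "int \<Rightarrow> nat \<Rightarrow> 'a::comm_ring_1 \<Rightarrow> 'a \<Rightarrow> 'a" where
  "expansion_poly d m p s = (\<Sum>k\<le>m. of_int (expansion_coeff d m k) * p ^ (m - k) * s ^ k)"

lemma expansion_poly_Suc_Suc:
  "expansion_poly d (Suc (Suc m)) p s =
     s * expansion_poly d (Suc m) p s - p\<^sup>2 * expansion_poly d m p s"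
proof -
  let ?c = "\<lambda>m k. of_int (expansion_coeff d m k) :: 'a"
  have "expansion_poly d (Suc (Suc m)) p s =
     (\<Sum>k\<le>Suc (Suc m). (if k = 0 then 0 else ?c (Suc m) (k - 1)) * p ^ (Suc (Suc m) - k) * s ^ k)
     - (\<Sum>k\<le>Suc (Suc m). ?c m k * p ^ (Suc (Suc m) - k) * s ^ k)"
    unfolding expansion_poly_def sum_subtractf [symmetric]
    by (intro sum.cong) (auto simp: algebra_simps)
  also have "(\<Sum>k\<le>Suc (Suc m). (if k = 0 then 0 else ?c (Suc m) (k - 1)) *
       p ^ (Suc (Suc m) - k) * s ^ k) = s * expansion_poly d (Suc m) p s"
    unfolding expansion_poly_def
    by (subst sum.atMost_Suc_shift) (simp add: sum_distrib_left mult_ac del: sum.atMost_Suc)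
  \<comment> \<open>Row \<open>m\<close> vanishes in columns \<open>m + 1\<close> and
    \<open>m + 2\<close>; in the remaining columns the exponent of \<open>p\<close> is at least 2,
    so \<open>p\<^sup>2\<close> factors out.\<close>
  also have "(\<Sum>k\<le>Suc (Suc m). ?c m k * p ^ (Suc (Suc m) - k) * s ^ k) =
       (\<Sum>k\<le>m. ?c m k * p ^ (Suc (Suc m) - k) * s ^ k)"
    by (simp add: expansion_coeff_eq_0)
  also have "\<dots> = p\<^sup>2 * expansion_poly d m p s"
    unfolding expansion_poly_def sum_distrib_left
    by (intro sum.cong) (auto simp: Suc_diff_le power2_eq_square mult_ac)
  finally show ?thesis .
qed

text \<open>A second-order recurrence is determined by its first two values. This identifies the
  quotients with the coefficient sums.\<close>

lemma expansion_poly_unique: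
  fixes F :: "nat \<Rightarrow> 'a::comm_ring_1"
  assumes "F 0 = 2 - of_int d" "F 1 = s - of_int d * p"
    and "\<And>m. F (Suc (Suc m)) = s * F (Suc m) - p\<^sup>2 * F m"
  shows "F m = expansion_poly d m p s"
proof (induction m rule: nat_less_induct)
  case (1 m)
  consider "m = 0" | "m = 1" | j where "m = Suc (Suc j)"
    by (metis One_nat_def not0_implies_Suc)
  then show ?case
  proof cases
    case (3 j)
    with 1 show ?thesis by (simp add: assms(3) expansion_poly_Suc_Suc)
  qed (use assms in \<open>auto simp: expansion_poly_def\<close>)
qed

section \<open>Existence and uniqueness of the expansion\<close>

text \<open>For fixed parity the denominator is constant, and the numerators combine powers of
  \<open>x\<^sup>2\<close> and \<open>y\<^sup>2\<close>, the roots of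
  \<open>z\<^sup>2 - (x\<^sup>2 + y\<^sup>2) z + (x y)\<^sup>2\<close>; this gives the
  recurrence.\<close>

lemma is_expansion_expansion_coeff:
  "is_expansion n (\<lambda>k. of_int (expansion_coeff (int (delta n)) (n div 2) k))"
  unfolding is_expansion_def
proof (intro allI impI)
  fix x y :: complex
  assume nz: "odd n \<longrightarrow> x + y \<noteq> 0"
  define d where "d = delta n"
  define F where "F m = (x ^ (2 * m + d) + y ^ (2 * m + d)) / (x + y) ^ d" for m
  have d: "d = 0 \<or> d = 1 \<and> x + y \<noteq> 0"
    using nz by (auto simp: d_def delta_def odd_iff_mod_2_eq_one)
  have rec: "F (Suc (Suc m)) = (x\<^sup>2 + y\<^sup>2) * F (Suc m) - (x * y)\<^sup>2 * F m" for m
    by (simp add: F_def diff_divide_distrib [symmetric])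
      (simp add: power2_eq_square algebra_simps)
  have "F (n div 2) = expansion_poly (int d) (n div 2) (x * y) (x\<^sup>2 + y\<^sup>2)"
  proof (rule expansion_poly_unique [where F = F, OF _ _ rec])
    show "F 0 = 2 - of_int (int d)"
      using d by (auto simp: F_def)
    show "F 1 = x\<^sup>2 + y\<^sup>2 - of_int (int d) * (x * y)"
      using d by (auto simp: F_def field_simps power2_eq_square eval_nat_numeral)
  qed
  moreover have "2 * (n div 2) + d = n"
    by (simp add: d_def delta_def)
  ultimately show "(x ^ n + y ^ n) / (x + y) ^ delta n =
      (\<Sum>k = 0..n div 2. of_int (expansion_coeff (int (delta n)) (n div 2) k) *
         (x * y) ^ (n div 2 - k) * (x\<^sup>2 + y\<^sup>2) ^ k)"
    by (simp add: F_def d_def expansion_poly_def atMost_atLeast0)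
qed

text \<open>Restricting to \<open>x y = 1\<close> leaves a polynomial in \<open>x\<^sup>2 + y\<^sup>2\<close>, which takes all values
  other than \<open>-2\<close> on pairs with \<open>x + y \<noteq> 0\<close>.\<close>

lemma is_expansion_unique:
  assumes c: "is_expansion n c" and c': "is_expansion n c'" and k: "k \<le> n div 2"
  shows "c k = c' k"
proof (rule ccontr)
  assume "c k \<noteq> c' k"
  then have fin: "finite {t. (\<Sum>i\<le>n div 2. (c i - c' i) * t ^ i) = 0}"
    using k polyfun_rootbound [of "\<lambda>i. c i - c' i" k "n div 2"] by auto
  have "(\<Sum>i\<le>n div 2. (c i - c' i) * t ^ i) = 0" if t: "t \<noteq> -2" for t :: complex
  proof -
    \<comment> \<open>If \<open>x y = 1\<close>, then \<open>(x + y)\<^sup>2 = t + 2\<close>. So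
      \<open>w\<close> is the intended \<open>x + y\<close>, nonzero because \<open>t\<close> is not
      -2, and \<open>x\<close>, \<open>y\<close> are the roots of
      \<open>z\<^sup>2 - w z + 1\<close>.\<close>
    define w where "w = csqrt (t + 2)"
    define x where "x = (w + csqrt (w\<^sup>2 - 4)) / 2"
    define y where "y = w - x"
    have w: "w\<^sup>2 = t + 2" by (simp add: w_def)
    have "w \<noteq> 0"
    proof
      assume "w = 0"
      with w have "t + 2 = 0" by simp
      with t show False by (simp add: eq_neg_iff_add_eq_0)
    qed
    have "2 * x - w = csqrt (w\<^sup>2 - 4)" by (simp add: x_def del: distrib_left_numeral)
    then have "(2 * x - w)\<^sup>2 = w\<^sup>2 - 4" by simp
    moreover have "4 * (x * y) = w\<^sup>2 - (2 * x - w)\<^sup>2"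
      by (simp add: y_def power2_eq_square algebra_simps)
    ultimately have p: "x * y = 1" by simp
    have "x\<^sup>2 + y\<^sup>2 = (x + y)\<^sup>2 - 2 * (x * y)"
      by (simp add: power2_eq_square algebra_simps)
    then have s: "x\<^sup>2 + y\<^sup>2 = t"
      using p w by (simp add: y_def)
    have "x + y \<noteq> 0" using \<open>w \<noteq> 0\<close> by (simp add: y_def)
    then have "(x ^ n + y ^ n) / (x + y) ^ delta n =
        (\<Sum>i = 0..n div 2. b i * (x * y) ^ (n div 2 - i) * (x\<^sup>2 + y\<^sup>2) ^ i)"
      if "is_expansion n b" for b
      using that unfolding is_expansion_def by blast
    from this [OF c] this [OF c'] show ?thesis
      by (simp add: p s sum_subtractf algebra_simps atMost_atLeast0)
  qed
  then have "- {-2} \<subseteq> {t. (\<Sum>i\<le>n div 2. (c i - c' i) * t ^ i) = 0}"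
    by auto
  with fin have "finite (- {-2 :: complex})"
    using finite_subset by blast
  then show False
    by (simp add: infinite_UNIV_char_0)
qed

lemma ex1_expansion: "\<exists>!c. is_expansion n c \<and> (\<forall>k > n div 2. c k = 0)"
proof (rule ex1I)
  show "is_expansion n (\<lambda>k. of_int (expansion_coeff (int (delta n)) (n div 2) k)) \<and>
      (\<forall>k > n div 2. of_int (expansion_coeff (int (delta n)) (n div 2) k) = (0 :: complex))"
    by (simp add: is_expansion_expansion_coeff expansion_coeff_eq_0)
next
  fix c
  assume "is_expansion n c \<and> (\<forall>k > n div 2. c k = 0)"
  then show "c = (\<lambda>k. of_int (expansion_coeff (int (delta n)) (n div 2) k))"
    using is_expansion_unique [OF _ is_expansion_expansion_coeff]
    by (intro ext) (metis expansion_coeff_eq_0 linorder_not_less of_int_0)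
qed

text \<open>Trades the definite description for recursively computed integers, from which
  integrality is immediate.\<close>

lemma Psi_eq: "Psi n k = of_int (expansion_coeff (int (delta n)) (n div 2) k)"
proof -
  have "Psi n = (\<lambda>k. of_int (expansion_coeff (int (delta n)) (n div 2) k))"
    unfolding Psi_def
    by (rule the1_equality [OF ex1_expansion])
      (simp add: is_expansion_expansion_coeff expansion_coeff_eq_0)
  then show ?thesis by simp
qed

subsection \<open>Central factorials\<close>

text \<open>The factors form a progression of step 4 symmetric about \<open>x\<close>, from
  \<open>x - 2 (k - 1)\<close> to \<open>x + 2 (k - 1)\<close>.\<close>

definition central_fact4 :: "nat \<Rightarrow> 'a::comm_ring_1 \<Rightarrow> 'a" where
  "central_fact4 k x = (\<Prod>i<k. x + 2 + 4 * of_nat i - 2 * of_nat k)"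

lemma central_fact4_0 [simp]: "central_fact4 0 x = 1"
  by (simp add: central_fact4_def)

lemma central_fact4_Suc_0 [simp]: "central_fact4 (Suc 0) x = x"
  by (simp add: central_fact4_def)

text \<open>Raising the centre by 2 while adding a factor keeps the old factors and appends one at
  the top; \<open>central_fact4_Suc_down\<close> is the mirror image.\<close>

lemma central_fact4_Suc_up:
  "central_fact4 (Suc k) (x + 2) = central_fact4 k x * (x + 2 + 2 * of_nat k)"
  by (simp add: central_fact4_def algebra_simps)

lemma central_fact4_Suc_down:
  "central_fact4 (Suc k) (x - 2) = central_fact4 k x * (x - 2 - 2 * of_nat k)"
  unfolding central_fact4_def
  by (subst prod.lessThan_Suc_shift) (simp add: algebra_simps)

lemma central_fact4_Suc_Suc:
  "central_fact4 (Suc (Suc k)) x = central_fact4 k x * (x\<^sup>2 - (2 * of_nat k + 2)\<^sup>2)"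
  using central_fact4_Suc_up [of "Suc k" "x - 2"] central_fact4_Suc_down [of k x]
  by (simp add: power2_eq_square algebra_simps)

lemma central_fact4_even:
  "central_fact4 (2 * h) x = (\<Prod>l\<in>{1..h}. x\<^sup>2 - (4 * of_nat l - 2)\<^sup>2)"
  by (induction h) (simp_all add: central_fact4_Suc_Suc algebra_simps)

lemma central_fact4_odd:
  "central_fact4 (Suc (2 * h)) x = x * (\<Prod>l\<in>{1..h}. x\<^sup>2 - (4 * of_nat l)\<^sup>2)"
  by (induction h) (simp_all add: central_fact4_Suc_Suc mult_ac power2_eq_square distrib_left)

text \<open>The extra \<open>x\<close> squares the middle factor, which becomes the term
  \<open>l = 0\<close>.\<close>

lemma central_fact4_odd_times:
  "x * central_fact4 (Suc (2 * h)) x = (\<Prod>l\<in>{0..<Suc h}. x\<^sup>2 - (4 * of_nat l)\<^sup>2)"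
proof -
  have "{0..<Suc h} = insert 0 {1..h}" by auto
  then show ?thesis by (simp add: central_fact4_odd power2_eq_square mult.assoc)
qed

text \<open>Both terms contain \<open>central_fact4 k x\<close>, and their remaining linear factors
  differ by \<open>4 (k + 1)\<close>: a discrete analogue of differentiating a power.\<close>

lemma central_fact4_diff:
  "central_fact4 (Suc k) (x + 2) - central_fact4 (Suc k) (x - 2) =
     4 * of_nat (Suc k) * central_fact4 k x"
  by (simp add: central_fact4_Suc_up central_fact4_Suc_down algebra_simps)

lemma central_fact4_times_diff:
  "(x + 2) * central_fact4 (Suc k) (x + 2) - (x - 2) * central_fact4 (Suc k) (x - 2) =
     4 * of_nat (Suc (Suc k)) * (x * central_fact4 k x)"
  by (simp add: central_fact4_Suc_up central_fact4_Suc_down algebra_simps)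

lemma central_fact4_eq_0: "i < k \<Longrightarrow> x + 2 + 4 * of_nat i = 2 * of_nat k \<Longrightarrow> central_fact4 k x = 0"
  unfolding central_fact4_def by (rule prod_zero) auto

text \<open>With a natural number as argument, locating the zero factor is arithmetic in
  \<open>nat\<close>. This serves the vanishing entries of the base rows.\<close>

lemma central_fact4_eq_0':
  assumes "x = of_nat a" "a + 2 + 4 * i = 2 * k" "i < k"
  shows "central_fact4 k x = 0"
proof (rule central_fact4_eq_0)
  have "of_nat (a + 2 + 4 * i) = (of_nat (2 * k) :: 'a)"
    using assms by simp
  then show "x + 2 + 4 * of_nat i = 2 * of_nat k" using assms(1) by (simp add: add_ac)
qed (use assms in auto)

text \<open>The sign exponent is congruent modulo 2 to \<open>\<lceil>(m - k) / 2\<rceil>\<close>; in this form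
  it involves no truncated subtraction.\<close>

definition closed_odd :: "nat \<Rightarrow> nat \<Rightarrow> 'a::field_char_0" where
  "closed_odd m k =
     (-1) ^ ((m + k + 1) div 2 + k) *
     central_fact4 k (if even (m + k) then 2 * of_nat m + 2 else 2 * of_nat m) / (4 ^ k * fact k)"

text \<open>Replacing \<open>y\<close> by \<open>-y\<close> negates only \<open>x y\<close>, so for
  even \<open>n\<close> only even powers of \<open>x y\<close> occur; hence the zero branch.
  Elsewhere the numerator is, up to sign, twice the classical central factorial at step 4,
  \<open>x * central_fact4 (k - 1) x\<close> with \<open>x = 2 m\<close>, whose value in degree 0 is
  1.\<close>

definition closed_even :: "nat \<Rightarrow> nat \<Rightarrow> 'a::field_char_0" where
  "closed_even m k =
     (if odd (m + k) then 0
      else (-1) ^ ((m + k) div 2 + k) *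
        (case k of 0 \<Rightarrow> 2 | Suc j \<Rightarrow> 4 * of_nat m * central_fact4 j (2 * of_nat m)) / (4 ^ k * fact k))"

section \<open>Agreement of the closed forms with the recurrence\<close>

lemma of_int_expansion_coeff_odd:
  "of_int (expansion_coeff 1 m k) = (closed_odd m k :: 'a::field_char_0)"
proof (induction "1 :: int" m k rule: expansion_coeff.induct)
  case (1 k)
  show ?case
  proof (cases "k = 0")
    case False
    have "central_fact4 k (if even k then 2 else 0 :: 'a) = 0"
    proof (cases "even k")
      case True
      with False show ?thesis
        by (auto elim!: evenE intro!: central_fact4_eq_0' [where a = 2 and i = "k div 2 - 1"])
    next
      case odd: False
      then show ?thesis
        by (auto elim!: oddE intro!: central_fact4_eq_0' [where a = 0 and i = "k div 2"])
    qed
    with False show ?thesis by (auto simp: closed_odd_def)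
  qed (simp add: closed_odd_def)
next
  case (2 k)
  consider "k = 0" | "k = 1" | "k \<ge> 2" by linarith
  then show ?case
  proof cases
    case 3
    have "central_fact4 k (if even k then 2 else 4 :: 'a) = 0"
    proof (cases "even k")
      case True
      with 3 show ?thesis
        by (auto elim!: evenE intro!: central_fact4_eq_0' [where a = 2 and i = "k div 2 - 1"])
    next
      case odd: False
      with 3 show ?thesis
        by (auto elim!: oddE intro!: central_fact4_eq_0' [where a = 4 and i = "k div 2 - 1"])
    qed
    with 3 show ?thesis by (auto simp: closed_odd_def)
  qed (auto simp: closed_odd_def)
next
  case (3 m k)
  show ?case
  proof (cases k)
    case 0
    with 3 show ?thesis by (simp add: closed_odd_def)
  next
    case (Suc j)
    \<comment> \<open>\<open>x\<close> and \<open>e\<close> are the argument and sign of the entry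
      in row \<open>m + 1\<close>, column \<open>j\<close>. In column \<open>k\<close>, rows
      \<open>m + 2\<close> and \<open>m\<close> have arguments \<open>x + 2\<close> and
      \<open>x - 2\<close> and signs \<open>e\<close> and \<open>-e\<close>, so the recurrence
      becomes \<open>central_fact4_diff\<close>.\<close>
    define x :: 'a where "x = (if even (m + k) then 2 * of_nat m + 4 else 2 * of_nat m + 2)"
    define e :: 'a where "e = (-1) ^ ((m + k + 1) div 2 + j)"
    have 1: "closed_odd (Suc (Suc m)) k = e * central_fact4 (Suc j) (x + 2) / (4 ^ k * fact k)"
      by (simp add: closed_odd_def x_def e_def Suc algebra_simps)
    have 2: "closed_odd m k = - (e * central_fact4 (Suc j) (x - 2) / (4 ^ k * fact k))"
      by (simp add: closed_odd_def x_def e_def Suc algebra_simps)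
    have 4: "closed_odd (Suc m) j = e * central_fact4 j x / (4 ^ j * fact j)"
      by (simp add: closed_odd_def x_def e_def Suc algebra_simps)
    have "central_fact4 (Suc j) (x + 2) =
        central_fact4 (Suc j) (x - 2) + 4 * of_nat (Suc j) * central_fact4 j x"
      using central_fact4_diff [of j x] by (simp add: algebra_simps)
    then have "closed_odd (Suc (Suc m)) k = closed_odd (Suc m) j - (closed_odd m k :: 'a)"
      unfolding 1 2 4 by (simp add: Suc field_simps del: of_nat_Suc)
    with 3 Suc show ?thesis by simp
  qed
qed

lemma of_int_expansion_coeff_even:
  "of_int (expansion_coeff 0 m k) = (closed_even m k :: 'a::field_char_0)"
proof (induction "0 :: int" m k rule: expansion_coeff.induct)
  case (1 k)
  show ?case by (simp add: closed_even_def split: nat.split)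
next
  case (2 k)
  consider "k = 0" | "k = 1" | "k \<ge> 2" by linarith
  then show ?case
  proof cases
    case 3
    then obtain j where k: "k = Suc j" "j > 0" by (cases k) auto
    \<comment> \<open>For odd \<open>j\<close> the entry is already zero by parity.\<close>
    have "central_fact4 j (2 :: 'a) = 0" if "even j"
      using that k
      by (auto elim!: evenE intro!: central_fact4_eq_0' [where a = 2 and i = "j div 2 - 1"])
    with k show ?thesis by (auto simp: closed_even_def)
  qed (auto simp: closed_even_def)
next
  case (3 m k)
  \<comment> \<open>Column 1 refers back to column 0, whose entries are not of product form.\<close>
  consider "k = 0" | "k = 1" | i where "k = Suc (Suc i)"
    by (metis One_nat_def not0_implies_Suc)
  then show ?case
  proof cases
    case 1
    with 3 show ?thesis by (simp add: closed_even_def)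
  next
    case 2
    with 3 show ?thesis by (auto simp: closed_even_def field_simps)
  next
    case k: (3 i)
    show ?thesis
    proof (cases "even (m + i)")
      case False
      with 3 k show ?thesis by (simp add: closed_even_def)
    next
      case True
      define x :: 'a where "x = 2 * of_nat m + 2"
      define e :: 'a where "e = (-1) ^ ((m + i) div 2 + i)"
      let ?D = "4 ^ k * fact k :: 'a"
      have 1: "closed_even (Suc (Suc m)) k = e * (2 * ((x + 2) * central_fact4 (Suc i) (x + 2))) / ?D"
        using True by (simp add: closed_even_def x_def e_def k algebra_simps)
      have 2: "closed_even m k = - (e * (2 * ((x - 2) * central_fact4 (Suc i) (x - 2))) / ?D)"
        using True by (simp add: closed_even_def x_def e_def k algebra_simps)
      have 4: "closed_even (Suc m) (Suc i) =
          e * (2 * (x * central_fact4 i x)) / (4 ^ Suc i * fact (Suc i))"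
        using True by (simp add: closed_even_def x_def e_def algebra_simps)
      have "(x + 2) * central_fact4 (Suc i) (x + 2) =
          (x - 2) * central_fact4 (Suc i) (x - 2) + 4 * of_nat (Suc (Suc i)) * (x * central_fact4 i x)"
        using central_fact4_times_diff [of x i] by (simp add: algebra_simps)
      moreover have "?D = 4 * of_nat (Suc (Suc i)) * (4 ^ Suc i * fact (Suc i))"
        by (simp add: k)
      \<comment> \<open>Opaque variables keep the central factorials from being expanded while
        denominators are cleared.\<close>
      moreover have "e * (2 * A) / D = e * (2 * C) / E - - (e * (2 * B) / D)"
        if "A = B + r * C" "D = r * E" "r \<noteq> 0" for A B C D E r :: 'a
        using that by (cases "E = 0") (simp_all add: field_simps)
      moreover have "4 * of_nat (Suc (Suc i)) \<noteq> (0 :: 'a)"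
        by (simp del: of_nat_Suc)
      ultimately have "closed_even (Suc (Suc m)) k =
          closed_even (Suc m) (Suc i) - (closed_even m k :: 'a)"
        unfolding 1 2 4 by blast
      with 3 k show ?thesis by simp
    qed
  qed
qed

subsection \<open>Coefficients by residue class\<close>

lemma Psi_double: "Psi (2 * m) k = closed_even m k"
  by (simp add: Psi_eq delta_def of_int_expansion_coeff_even)

lemma Psi_Suc_double: "Psi (Suc (2 * m)) k = closed_odd m k"
  by (simp add: Psi_eq delta_def of_int_expansion_coeff_odd mod2_eq_if)

text \<open>Classes modulo 8 that agree modulo 4 differ only by a sign, carried by
  \<open>(-1) ^ (n div 4)\<close>; the lemmas for positive \<open>k\<close> use the same
  grouping.\<close>

lemma Psi_0:
  shows "n mod 4 = 0 \<Longrightarrow> Psi n 0 = 2 * (-1) ^ (n div 4)"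
    and "n mod 4 = 1 \<Longrightarrow> Psi n 0 = (-1) ^ (n div 4)"
    and "n mod 4 = 2 \<Longrightarrow> Psi n 0 = 0"
    and "n mod 4 = 3 \<Longrightarrow> Psi n 0 = - ((-1) ^ (n div 4))"
proof -
  define q where "q = n div 4"
  show "Psi n 0 = 2 * (-1) ^ (n div 4)" if "n mod 4 = 0"
  proof -
    from that have "n = 2 * (2 * q)" unfolding q_def by presburger
    then have "Psi n 0 = closed_even (2 * q) 0" by (simp only: Psi_double)
    then show ?thesis by (simp add: closed_even_def flip: q_def)
  qed
  show "Psi n 0 = (-1) ^ (n div 4)" if "n mod 4 = 1"
  proof -
    from that have "n = Suc (2 * (2 * q))" unfolding q_def by presburger
    then have "Psi n 0 = closed_odd (2 * q) 0" by (simp only: Psi_Suc_double)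
    then show ?thesis by (simp add: closed_odd_def flip: q_def)
  qed
  show "Psi n 0 = 0" if "n mod 4 = 2"
  proof -
    from that have "n = 2 * (2 * q + 1)" unfolding q_def by presburger
    then have "Psi n 0 = closed_even (2 * q + 1) 0" by (simp only: Psi_double)
    then show ?thesis by (simp add: closed_even_def)
  qed
  show "Psi n 0 = - ((-1) ^ (n div 4))" if "n mod 4 = 3"
  proof -
    from that have "n = Suc (2 * (2 * q + 1))" unfolding q_def by presburger
    then have "Psi n 0 = closed_odd (2 * q + 1) 0" by (simp only: Psi_Suc_double)
    then show ?thesis by (simp add: closed_odd_def flip: q_def)
  qed
qed

lemma Psi_mod4_eq_0:
  assumes n: "n mod 4 = 0" and k: "k > 0"
  shows "Psi n k =
    (if odd k then 0
     else 2 * (-1) ^ (n div 4 + k div 2) *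
       (\<Prod>l \<in> {0..<k div 2}. (of_nat n)\<^sup>2 - (4 * of_nat l)\<^sup>2) / (4 ^ k * fact k))"
proof -
  from n obtain q where q: "n = 4 * q" by auto
  have Psi: "Psi n k = closed_even (2 * q) k"
    by (simp add: q flip: Psi_double)
  show ?thesis
  proof (cases "odd k")
    case True
    then show ?thesis by (simp add: Psi closed_even_def)
  next
    case False
    define h where "h = k div 2 - 1"
    have h: "k = 2 * Suc h"
      using False k unfolding h_def by presburger
    have sign: "(-1 :: complex) ^ ((2 * q + k) div 2 + k) = (-1) ^ (n div 4 + k div 2)"
      by (simp add: h q minus_one_power_iff)
    have n': "2 * of_nat (2 * q) = (of_nat n :: complex)" by (simp add: q)
    have "closed_even (2 * q) k = (-1) ^ (n div 4 + k div 2) *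
        (2 * (2 * of_nat (2 * q) * central_fact4 (Suc (2 * h)) (2 * of_nat (2 * q)))) /
        (4 ^ k * fact k :: complex)"
      unfolding closed_even_def sign by (simp add: h del: of_nat_add of_nat_mult)
    then show ?thesis
      unfolding Psi n' central_fact4_odd_times by (simp add: h mult_ac)
  qed
qed

lemma Psi_mod4_eq_2:
  assumes n: "n mod 4 = 2"
  shows "Psi n k =
    (if even k then 0
     else 2 * (-1) ^ (n div 4 + k div 2) * of_nat n *
       (\<Prod>l \<in> {1..k div 2}. (of_nat n)\<^sup>2 - (4 * of_nat l - 2)\<^sup>2) / (4 ^ k * fact k))"
proof -
  from n obtain q where q: "n = 4 * q + 2"
    by (metis mult_div_mod_eq)
  then have div: "n div 4 = q" by simp
  have Psi: "Psi n k = closed_even (2 * q + 1) k"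
    by (simp add: q flip: Psi_double)
  show ?thesis
  proof (cases "even k")
    case True
    then show ?thesis by (simp add: Psi closed_even_def)
  next
    case False
    then obtain h where h: "k = Suc (2 * h)"
      by (auto elim: oddE)
    have sign: "(-1 :: complex) ^ ((2 * q + 1 + k) div 2 + k) = (-1) ^ (n div 4 + k div 2)"
      by (simp add: h div minus_one_power_iff)
    have n': "2 * of_nat (2 * q + 1) = (of_nat n :: complex)" by (simp add: q)
    have "closed_even (2 * q + 1) k = (-1) ^ (n div 4 + k div 2) *
        (2 * (2 * of_nat (2 * q + 1)) * central_fact4 (2 * h) (2 * of_nat (2 * q + 1))) /
        (4 ^ k * fact k :: complex)"
      unfolding closed_even_def sign by (simp add: h del: of_nat_add of_nat_mult)
    then show ?thesis
      unfolding Psi n' central_fact4_even by (simp add: h mult_ac)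
  qed
qed

lemma Psi_mod4_eq_1:
  assumes n: "n mod 4 = 1"
  shows "Psi n k =
    (-1) ^ (n div 4 + k div 2) * (of_nat n + 1 - 2 * of_nat k) ^ delta k *
    (\<Prod>l \<in> {1..k div 2}. (of_nat n + 1)\<^sup>2 - (4 * of_nat l - 2)\<^sup>2) / (4 ^ k * fact k)"
proof -
  from n obtain q where q: "n = 4 * q + 1"
    by (metis mult_div_mod_eq)
  then have div: "n div 4 = q" by simp
  define h where "h = k div 2"
  have h: "k = 2 * h \<or> k = Suc (2 * h)"
    unfolding h_def by presburger
  define x :: complex where "x = of_nat n + 1"
  have Psi: "Psi n k = closed_odd (2 * q) k"
    by (simp add: q flip: Psi_Suc_double)
  have sign: "(-1 :: complex) ^ ((2 * q + k + 1) div 2 + k) = (-1) ^ (n div 4 + k div 2)"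
    using h by (auto simp: div minus_one_power_iff)
  have arg: "(if even (2 * q + k) then 2 * of_nat (2 * q) + 2 else 2 * of_nat (2 * q)) =
      (if even k then x else x - 2)"
    by (simp add: x_def q)
  \<comment> \<open>For odd \<open>k\<close> the centre is \<open>n - 1\<close>; splitting off the
    lowest factor, \<open>n + 1 - 2 k\<close>, recentres the rest at \<open>n + 1\<close>.\<close>
  have fact4: "central_fact4 k (if even k then x else x - 2) =
      (x - 2 * of_nat k) ^ delta k * central_fact4 (2 * (k div 2)) x"
    using h by (auto simp: delta_def mod2_eq_if central_fact4_Suc_down algebra_simps)
  show ?thesis
    unfolding Psi closed_odd_def sign arg fact4 central_fact4_even x_def [symmetric]
    by (simp only: mult.assoc)
qed

lemma Psi_mod4_eq_3:
  assumes n: "n mod 4 = 3" and k: "k > 0"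
  shows "Psi n k =
    (-1) ^ (n div 4 + k div 2 + delta (k - 1)) * (of_nat n + 1) *
    (of_nat n + 1 - 2 * of_nat k) ^ delta (k - 1) *
    (\<Prod>l \<in> {1..(k - 1) div 2}. (of_nat n + 1)\<^sup>2 - (4 * of_nat l)\<^sup>2) / (4 ^ k * fact k)"
proof -
  from n obtain q where q: "n = 4 * q + 3"
    by (metis mult_div_mod_eq)
  then have div: "n div 4 = q" by simp
  from k obtain j where j: "k = Suc j"
    using gr0_implies_Suc by blast
  define h where "h = j div 2"
  have h: "j = 2 * h \<or> j = Suc (2 * h)"
    unfolding h_def by presburger
  define x :: complex where "x = of_nat n + 1"
  have Psi: "Psi n k = closed_odd (2 * q + 1) k"
    by (simp add: q numeral_3_eq_3 flip: Psi_Suc_double)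
  have sign: "(-1 :: complex) ^ ((2 * q + 1 + k + 1) div 2 + k) =
      (-1) ^ (n div 4 + k div 2 + delta (k - 1))"
    using h by (auto simp: div j delta_def minus_one_power_iff)
  have arg: "(if even (2 * q + 1 + k) then 2 * of_nat (2 * q + 1) + 2 else 2 * of_nat (2 * q + 1)) =
      (if even j then x else x - 2)"
    by (simp add: x_def q j)
  \<comment> \<open>The same recentring applies for even \<open>k\<close>; what remains has an odd
    number of factors, and its middle one supplies \<open>n + 1\<close>.\<close>
  have fact4: "central_fact4 k (if even j then x else x - 2) =
      (x - 2 * of_nat k) ^ delta j * central_fact4 (Suc (2 * (j div 2))) x"
    using h by (auto simp: j delta_def mod2_eq_if central_fact4_Suc_down algebra_simps)
  have "k - 1 = j" by (simp add: j)
  then show ?thesis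
    unfolding Psi closed_odd_def sign arg fact4 central_fact4_odd x_def [symmetric]
    by (simp only: mult_ac)
qed

section \<open>Assembly of the classes modulo 8\<close>

theorem theorem9:
  fixes n :: nat
  shows
    "(\<exists>!c. is_expansion n c \<and> (\<forall>k > n div 2. c k = 0)) \<and>
     is_expansion n (Psi n) \<and>
     (\<forall>k \<le> n div 2. Psi n k \<in> \<int>) \<and>
     (n mod 8 = 0 \<longrightarrow> Psi n 0 = 2) \<and>
     (n mod 8 = 1 \<or> n mod 8 = 7 \<longrightarrow> Psi n 0 = 1) \<and>
     (n mod 8 = 2 \<or> n mod 8 = 6 \<longrightarrow> Psi n 0 = 0) \<and>
     (n mod 8 = 3 \<or> n mod 8 = 5 \<longrightarrow> Psi n 0 = -1) \<and>
     (n mod 8 = 4 \<longrightarrow> Psi n 0 = -2) \<and>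
     (\<forall>k. 1 \<le> k \<and> k \<le> n div 2 \<longrightarrow>
       (n mod 8 = 0 \<longrightarrow>
          (odd k \<longrightarrow> Psi n k = 0) \<and>
          (even k \<longrightarrow> Psi n k =
             2 * (-1) ^ (k div 2) *
             (\<Prod>l \<in> {0..<k div 2}. (of_nat n)\<^sup>2 - (4 * of_nat l)\<^sup>2) / (4 ^ k * fact k))) \<and>
       (n mod 8 = 2 \<longrightarrow>
          (even k \<longrightarrow> Psi n k = 0) \<and>
          (odd k \<longrightarrow> Psi n k =
             2 * (-1) ^ (k div 2) * of_nat n *
             (\<Prod>l \<in> {1..k div 2}. (of_nat n)\<^sup>2 - (4 * of_nat l - 2)\<^sup>2) / (4 ^ k * fact k))) \<and>
       (n mod 8 = 4 \<longrightarrow>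
          (odd k \<longrightarrow> Psi n k = 0) \<and>
          (even k \<longrightarrow> Psi n k =
             2 * (-1) ^ (k div 2 + 1) *
             (\<Prod>l \<in> {0..<k div 2}. (of_nat n)\<^sup>2 - (4 * of_nat l)\<^sup>2) / (4 ^ k * fact k))) \<and>
       (n mod 8 = 6 \<longrightarrow>
          (even k \<longrightarrow> Psi n k = 0) \<and>
          (odd k \<longrightarrow> Psi n k =
             2 * (-1) ^ (k div 2 + 1) * of_nat n *
             (\<Prod>l \<in> {1..k div 2}. (of_nat n)\<^sup>2 - (4 * of_nat l - 2)\<^sup>2) / (4 ^ k * fact k))) \<and>
       (n mod 8 = 1 \<longrightarrow> Psi n k =
          (-1) ^ (k div 2) * (of_nat n + 1 - 2 * of_nat k) ^ delta k *
          (\<Prod>l \<in> {1..k div 2}. (of_nat n + 1)\<^sup>2 - (4 * of_nat l - 2)\<^sup>2) / (4 ^ k * fact k)) \<and>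
       (n mod 8 = 3 \<longrightarrow> Psi n k =
          (-1) ^ (k div 2 + delta (k - 1)) * (of_nat n + 1) *
          (of_nat n + 1 - 2 * of_nat k) ^ delta (k - 1) *
          (\<Prod>l \<in> {1..(k - 1) div 2}. (of_nat n + 1)\<^sup>2 - (4 * of_nat l)\<^sup>2) / (4 ^ k * fact k)) \<and>
       (n mod 8 = 5 \<longrightarrow> Psi n k =
          (-1) ^ (k div 2 + 1) * (of_nat n + 1 - 2 * of_nat k) ^ delta k *
          (\<Prod>l \<in> {1..k div 2}. (of_nat n + 1)\<^sup>2 - (4 * of_nat l - 2)\<^sup>2) / (4 ^ k * fact k)) \<and>
       (n mod 8 = 7 \<longrightarrow> Psi n k =
          (-1) ^ (k div 2 + delta k) * (of_nat n + 1) *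
          (of_nat n + 1 - 2 * of_nat k) ^ delta (k - 1) *
          (\<Prod>l \<in> {1..(k - 1) div 2}. (of_nat n + 1)\<^sup>2 - (4 * of_nat l)\<^sup>2) / (4 ^ k * fact k)))"
proof -
  have expansion: "is_expansion n (Psi n)"
    using is_expansion_expansion_coeff by (simp add: Psi_eq [abs_def])
  have int: "\<forall>k \<le> n div 2. Psi n k \<in> \<int>"
    by (simp add: Psi_eq)
  \<comment> \<open>In class 7 the odd \<open>n div 4\<close> contributes a minus sign, absorbed by
    writing \<open>delta k\<close> for \<open>delta (k - 1)\<close>.\<close>
  have delta_pred: "(-1 :: complex) ^ (i + delta k) = - ((-1) ^ (i + delta (k - 1)))"
    if "k > 0" for i k
    using that by (cases k) (auto simp: delta_def minus_one_power_iff mod2_eq_if)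
  have sign: "(-1 :: complex) ^ (n div 4 + i) = (-1) ^ (if n mod 8 < 4 then i else i + 1)" for i
  proof -
    have "even (n div 4) \<longleftrightarrow> n mod 8 < 4" by presburger
    then show ?thesis by (simp add: power_add)
  qed
  have Psi_0_cases:
    "n mod 8 = 0 \<longrightarrow> Psi n 0 = 2"
    "n mod 8 = 1 \<or> n mod 8 = 7 \<longrightarrow> Psi n 0 = 1"
    "n mod 8 = 2 \<or> n mod 8 = 6 \<longrightarrow> Psi n 0 = 0"
    "n mod 8 = 3 \<or> n mod 8 = 5 \<longrightarrow> Psi n 0 = -1"
    "n mod 8 = 4 \<longrightarrow> Psi n 0 = -2"
    using Psi_0 [of n] sign [of 0] mod_mod_cancel [of 4 8 n] by auto
  have mod4: "n mod 4 = r mod 4" if "n mod 8 = r" for r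
    using mod_mod_cancel [of 4 8 n] that by simp
  show ?thesis
    apply (intro conjI)
    subgoal by (rule ex1_expansion)
    subgoal by (rule expansion)
    subgoal by (rule int)
    subgoal by (rule Psi_0_cases)
    subgoal by (rule Psi_0_cases)
    subgoal by (rule Psi_0_cases)
    subgoal by (rule Psi_0_cases)
    subgoal by (rule Psi_0_cases)
    apply (intro allI impI conjI)
    subgoal for k using mod4 [of 0] Psi_mod4_eq_0 [of n k] by simp
    subgoal for k using mod4 [of 0] Psi_mod4_eq_0 [of n k] sign by simp
    subgoal for k using mod4 [of 2] Psi_mod4_eq_2 [of n k] by simp
    subgoal for k using mod4 [of 2] Psi_mod4_eq_2 [of n k] sign by simp
    subgoal for k using mod4 [of 4] Psi_mod4_eq_0 [of n k] by simp
    subgoal for k using mod4 [of 4] Psi_mod4_eq_0 [of n k] sign by simp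
    subgoal for k using mod4 [of 6] Psi_mod4_eq_2 [of n k] by simp
    subgoal for k using mod4 [of 6] Psi_mod4_eq_2 [of n k] sign by simp
    subgoal for k using mod4 [of 1] Psi_mod4_eq_1 [of n k] sign by simp
    subgoal for k using mod4 [of 3] Psi_mod4_eq_3 [of n k] sign by (simp add: add.assoc)
    subgoal for k using mod4 [of 5] Psi_mod4_eq_1 [of n k] sign by simp
    subgoal for k using mod4 [of 7] Psi_mod4_eq_3 [of n k] sign delta_pred [of k "k div 2"]
      by (simp add: add.assoc)
    done
qed

end
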